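(* Let $G$ be a connected $k$-regular bipartite graph. Then $rd(G)=k$.
   Context: All graphs are simple, finite and undirected. For an edge-coloring of $G$ (adjacent edges may receive the same color), an edge-cut $R$ is a rainbow cut if no two edges of $R$ have the same color; it is a $u$-$v$ rainbow cut if $u$ and $v$ lie in different components of $G-R$. $G$ is rainbow disconnected if every two vertices $u,v$ have a $u$-$v$ rainbow cut. For a nontrivial connected graph $G$, $rd(G)$ is the smallest number of colors in an edge-coloring making $G$ rainbow disconnected. *)

theory Defs
  imports Main
begin

text \<open>
  A finite simple undirected graph is given by its vertex set and its set of edges, each
  edge being a two-element set of vertices.
\<close>

locale simple_graph =
  fixes V :: "'a set" and E :: "'a set set"
  assumes finite_vertices: "finite V"
    and edge_subset: "e \<in> E \<Longrightarrow> e \<subseteq> V"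
    and edge_card: "e \<in> E \<Longrightarrow> card e = 2"

definition adjacent :: "'a set set \<Rightarrow> 'a \<Rightarrow> 'a \<Rightarrow> bool" where
  "adjacent E u v \<longleftrightarrow> {u, v} \<in> E"

definition reachable :: "'a set set \<Rightarrow> 'a \<Rightarrow> 'a \<Rightarrow> bool" where
  "reachable E = (adjacent E)\<^sup>*\<^sup>*"

definition component :: "'a set \<Rightarrow> 'a set set \<Rightarrow> 'a \<Rightarrow> 'a set" where
  "component V E v = {w \<in> V. reachable E v w}"

definition connected_graph :: "'a set \<Rightarrow> 'a set set \<Rightarrow> bool" where
  "connected_graph V E \<longleftrightarrow> V \<noteq> {} \<and> (\<forall>u\<in>V. \<forall>v\<in>V. reachable E u v)"

definition degree :: "'a set set \<Rightarrow> 'a \<Rightarrow> nat" where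
  "degree E v = card {e \<in> E. v \<in> e}"

definition regular_graph :: "nat \<Rightarrow> 'a set \<Rightarrow> 'a set set \<Rightarrow> bool" where
  "regular_graph k V E \<longleftrightarrow> (\<forall>v\<in>V. degree E v = k)"

definition bipartite_graph :: "'a set \<Rightarrow> 'a set set \<Rightarrow> bool" where
  "bipartite_graph V E \<longleftrightarrow>
    (\<exists>X Y. X \<union> Y = V \<and> X \<inter> Y = {} \<and> (\<forall>e\<in>E. \<exists>x\<in>X. \<exists>y\<in>Y. e = {x, y}))"

definition edge_cut :: "'a set \<Rightarrow> 'a set set \<Rightarrow> 'a set set \<Rightarrow> bool" where
  "edge_cut V E R \<longleftrightarrow> R \<subseteq> E \<and> \<not> connected_graph V (E - R)"

definition rainbow_cut :: "'a set \<Rightarrow> 'a set set \<Rightarrow> ('a set \<Rightarrow> nat) \<Rightarrow> 'a set set \<Rightarrow> bool" where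
  "rainbow_cut V E c R \<longleftrightarrow> edge_cut V E R \<and> inj_on c R"

definition separating_rainbow_cut ::
    "'a set \<Rightarrow> 'a set set \<Rightarrow> ('a set \<Rightarrow> nat) \<Rightarrow> 'a \<Rightarrow> 'a \<Rightarrow> 'a set set \<Rightarrow> bool" where
  "separating_rainbow_cut V E c u v R \<longleftrightarrow>
    rainbow_cut V E c R \<and> component V (E - R) u \<noteq> component V (E - R) v"

definition rainbow_disconnected :: "'a set \<Rightarrow> 'a set set \<Rightarrow> ('a set \<Rightarrow> nat) \<Rightarrow> bool" where
  "rainbow_disconnected V E c \<longleftrightarrow>
    (\<forall>u\<in>V. \<forall>v\<in>V. u \<noteq> v \<longrightarrow> (\<exists>R. separating_rainbow_cut V E c u v R))"

text \<open>
  Colorings are total functions, but only their values on \<open>E\<close> matter; adjacent edges may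
  share a color. The \<open>LEAST\<close> is over a nonempty set for every finite simple graph: if all
  edges get distinct colors, \<open>R = E\<close> separates any two distinct vertices.
\<close>

definition rd :: "'a set \<Rightarrow> 'a set set \<Rightarrow> nat" where
  "rd V E = (LEAST n. \<exists>c. c ` E \<subseteq> {1..n} \<and> rainbow_disconnected V E c)"

end

theory Submission
  imports Defs
begin

text \<open>
  Upper bound: by Koenig's edge coloring theorem, proved with Kempe chains, a \<open>k\<close>-regular
  bipartite graph has a proper edge coloring with \<open>k\<close> colors, and then the star of \<open>u\<close> is a
  rainbow cut separating \<open>u\<close> from every other vertex.

  Lower bound: a rainbow cut has at most as many edges as there are colors, so it suffices to find
  vertices \<open>s\<close> and \<open>t\<close> such that the star of \<open>s\<close> is a minimum \<open>s\<close>-\<open>t\<close> cut. Among all minimum cuts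
  of all pairs, a side of smallest size is a singleton: otherwise submodularity allows
  a minimum cut between two of its vertices to be moved strictly inside it.
\<close>

section \<open>Cut sizes, submodularity, and a minimum cut with a singleton side\<close>

definition boundary :: "'a set set \<Rightarrow> 'a set \<Rightarrow> 'a set set" where
  "boundary E S = {e \<in> E. e \<inter> S \<noteq> {} \<and> \<not> e \<subseteq> S}"

text \<open>Both the union and the intersection of the two boundaries on the left are contained in
  the corresponding set on the right; counting union plus intersection gives the inequality.\<close>

lemma card_boundary_submodular:
  assumes "finite E"
  shows "card (boundary E (S \<inter> T)) + card (boundary E (S \<union> T))
       \<le> card (boundary E S) + card (boundary E T)"
proof -
  have fin: "finite (boundary E A)" for A
    using assms by (simp add: boundary_def)
  have "boundary E (S \<inter> T) \<union> boundary E (S \<union> T) \<subseteq> boundary E S \<union> boundary E T"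
    and "boundary E (S \<inter> T) \<inter> boundary E (S \<union> T) \<subseteq> boundary E S \<inter> boundary E T"
    by (auto simp: boundary_def)
  then have "card (boundary E (S \<inter> T) \<union> boundary E (S \<union> T)) \<le> card (boundary E S \<union> boundary E T)"
    and "card (boundary E (S \<inter> T) \<inter> boundary E (S \<union> T)) \<le> card (boundary E S \<inter> boundary E T)"
    using fin by (auto intro: card_mono)
  then show ?thesis
    using card_Un_Int[OF fin fin, of "S \<inter> T" "S \<union> T"] card_Un_Int[OF fin fin, of S T] by linarith
qed

text \<open>A cut is represented by the side containing \<open>u\<close> instead of by its edges, so
  that sides can be intersected and compared in size.\<close>

definition min_cut :: "'a set \<Rightarrow> 'a set set \<Rightarrow> 'a \<Rightarrow> 'a \<Rightarrow> 'a set \<Rightarrow> bool" where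
  "min_cut V E u v S \<longleftrightarrow> S \<subseteq> V \<and> u \<in> S \<and> v \<in> V - S \<and>
     (\<forall>T\<subseteq>V. u \<in> T \<and> v \<notin> T \<longrightarrow> card (boundary E S) \<le> card (boundary E T))"

context simple_graph
begin

lemma finite_edges: "finite E"
  using finite_vertices edge_subset by (intro finite_subset[of E "Pow V"]) auto

lemma boundary_compl: "boundary E (V - S) = boundary E S"
  unfolding boundary_def using edge_subset by blast

lemma boundary_singleton: "boundary E {v} = {e \<in> E. v \<in> e}"
proof -
  have "\<not> e \<subseteq> {v}" if "e \<in> E" for e
    using card_mono[of "{v}" e] edge_card[OF that] by auto
  then show ?thesis
    by (auto simp: boundary_def)
qed

lemma min_cut_exists:
  assumes "u \<in> V" "v \<in> V" "u \<noteq> v"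
  shows "\<exists>S. min_cut V E u v S"
proof -
  have "\<exists>S. (S \<subseteq> V \<and> u \<in> S \<and> v \<notin> S) \<and>
      (\<forall>T. T \<subseteq> V \<and> u \<in> T \<and> v \<notin> T \<longrightarrow> card (boundary E S) \<le> card (boundary E T))"
    using assms by (intro ex_has_least_nat[where k = "{u}"]) auto
  then show ?thesis
    using assms by (auto simp: min_cut_def)
qed

lemma min_cut_compl:
  assumes "min_cut V E u v S"
  shows "min_cut V E v u (V - S)"
proof -
  have "card (boundary E S) \<le> card (boundary E T)" if "T \<subseteq> V" "v \<in> T" "u \<notin> T" for T
  proof -
    have "card (boundary E S) \<le> card (boundary E (V - T))"
      using assms that unfolding min_cut_def by blast
    then show ?thesis
      by (simp add: boundary_compl)
  qed
  then show ?thesis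
    using assms by (auto simp: min_cut_def boundary_compl)
qed

lemma singleton_min_cut_exists:
  assumes "card V \<ge> 2"
  shows "\<exists>s t. min_cut V E s t {s}"
proof -
  let ?P = "\<lambda>S. \<exists>u v. min_cut V E u v S"
  obtain p q where "p \<in> V" "q \<in> V" "p \<noteq> q"
    using assms finite_vertices by (metis card_2_iff' card_le_Suc0_iff_eq not_less_eq_eq numeral_2_eq_2)
  then have "\<exists>S. ?P S"
    using min_cut_exists by blast
  then obtain S where "?P S" and least: "\<And>T. ?P T \<Longrightarrow> card S \<le> card T"
    using ex_has_least_nat[of ?P _ card] by blast
  then obtain u v where uv: "min_cut V E u v S"
    by blast
  have "S = {u}"
  proof (rule ccontr)
    assume "S \<noteq> {u}"
    then obtain x where x: "x \<in> S" "x \<noteq> u"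
      using uv by (auto simp: min_cut_def)
    have finS: "finite S"
      using uv finite_vertices by (auto simp: min_cut_def intro: finite_subset)
    obtain T0 where T0: "min_cut V E u x T0"
      using min_cut_exists[of u x] uv x by (auto simp: min_cut_def)
    \<comment> \<open>Passing to the complement if needed makes the side avoid \<open>v\<close>; the
      price is that \<open>u\<close> and \<open>x\<close> may exchange roles.\<close>
    have "\<exists>T y z. min_cut V E y z T \<and> {y, z} = {u, x} \<and> v \<notin> T"
    proof (cases "v \<in> T0")
      case True
      then show ?thesis
        using min_cut_compl[OF T0] by blast
    next
      case False
      then show ?thesis
        using T0 by blast
    qed
    then obtain T y z where T: "min_cut V E y z T" "{y, z} = {u, x}" "v \<notin> T"
      by blast
    have yz: "y \<in> S" "z \<in> S" "z \<notin> T" "y \<in> T"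
      using T x uv by (auto simp: min_cut_def doubleton_eq_iff)
    \<comment> \<open>\<open>S \<union> T\<close> still separates \<open>u\<close> from
      \<open>v\<close>. By submodularity the saving must then fall on \<open>S \<inter> T\<close>,
      which separates \<open>y\<close> from \<open>z\<close> and is smaller than \<open>S\<close>
      because it omits \<open>z\<close>.\<close>
    have "card (boundary E S) \<le> card (boundary E (S \<union> T))"
      using uv T by (auto simp: min_cut_def)
    then have "card (boundary E (S \<inter> T)) \<le> card (boundary E T)"
      using card_boundary_submodular[OF finite_edges, of S T] by linarith
    then have "min_cut V E y z (S \<inter> T)"
      using T(1) yz unfolding min_cut_def by (meson Diff_iff IntD1 IntD2 IntI le_trans subset_iff)
    then have "card S \<le> card (S \<inter> T)"
      using least by blast
    moreover have "card (S \<inter> T) < card S"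
      using yz finS by (intro psubset_card_mono) auto
    ultimately show False
      by simp
  qed
  then show ?thesis
    using uv by blast
qed

end

section \<open>Lower bound on the number of colors\<close>

lemma reachable_sym:
  assumes "reachable E u v"
  shows "reachable E v u"
proof -
  have "symp (adjacent E)"
    by (auto simp: symp_def adjacent_def insert_commute)
  then show ?thesis
    using assms unfolding reachable_def by (metis sympD symp_rtranclp)
qed

lemma component_eq:
  assumes "reachable E u v"
  shows "component V E u = component V E v"
  using assms reachable_sym[OF assms]
  by (auto simp: component_def reachable_def intro: rtranclp_trans)

lemma rainbow_disconnected_lower_bound:
  assumes "simple_graph V E" "card V \<ge> 2" "regular_graph k V E"
    and "c ` E \<subseteq> {1..n}" "rainbow_disconnected V E c"
  shows "k \<le> n"
proof -
  interpret simple_graph V E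
    by fact
  obtain s t where st: "min_cut V E s t {s}"
    using singleton_min_cut_exists[OF assms(2)] by blast
  then have "s \<in> V" "t \<in> V" "s \<noteq> t"
    by (auto simp: min_cut_def)
  then obtain R where R: "separating_rainbow_cut V E c s t R"
    using assms(5) unfolding rainbow_disconnected_def by blast
  define T where "T = component V (E - R) s"
  have "R \<subseteq> E" "inj_on c R"
    using R by (auto simp: separating_rainbow_cut_def rainbow_cut_def edge_cut_def)
  then have "finite R"
    using finite_edges finite_subset by blast
  \<comment> \<open>An edge leaving the component of \<open>s\<close> would extend that component if
    it survived in \<open>E - R\<close>.\<close>
  have "boundary E T \<subseteq> R"
  proof
    fix e assume "e \<in> boundary E T"
    then obtain a b where e: "e \<in> E" "a \<in> e" "a \<in> T" "b \<in> e" "b \<notin> T"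
      by (auto simp: boundary_def)
    obtain p q where "e = {p, q}"
      using edge_card[OF e(1)] by (auto simp: card_2_iff)
    then have "e = {a, b}"
      using e by auto
    show "e \<in> R"
    proof (rule ccontr)
      assume "e \<notin> R"
      then have "adjacent (E - R) a b"
        using e \<open>e = {a, b}\<close> by (simp add: adjacent_def)
      then have "reachable (E - R) s b"
        using e(3) by (auto simp: T_def component_def reachable_def)
      then show False
        using e edge_subset by (auto simp: T_def component_def)
    qed
  qed
  then have "card (boundary E T) \<le> card R"
    using \<open>finite R\<close> by (rule card_mono[rotated])
  also have "card R \<le> card {1..n}"
    using \<open>R \<subseteq> E\<close> assms(4) by (intro card_inj_on_le[OF \<open>inj_on c R\<close>]) auto
  finally have "card (boundary E T) \<le> n"
    by simp
  moreover have "T \<subseteq> V" "s \<in> T"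
    using \<open>s \<in> V\<close> by (auto simp: T_def component_def reachable_def)
  moreover have "t \<notin> T"
    using R component_eq[of "E - R" s t V] by (auto simp: separating_rainbow_cut_def T_def component_def)
  ultimately have "card (boundary E {s}) \<le> n"
    using st unfolding min_cut_def by (meson le_trans)
  then show ?thesis
    using assms(3) \<open>s \<in> V\<close> by (simp add: boundary_singleton regular_graph_def degree_def)
qed

section \<open>Kempe chains and edge colorings of bipartite graphs\<close>

text \<open>Phrased by stars because injectivity on the star of a vertex is what makes that star
  rainbow.\<close>

definition proper_coloring :: "'a set set \<Rightarrow> ('a set \<Rightarrow> nat) \<Rightarrow> bool" where
  "proper_coloring E c \<longleftrightarrow> (\<forall>v. inj_on c {e \<in> E. v \<in> e})"

lemma proper_coloringD:
  "\<lbrakk>proper_coloring E c; e \<in> E; f \<in> E; v \<in> e; v \<in> f; c e = c f\<rbrakk> \<Longrightarrow> e = f"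
  by (auto simp: proper_coloring_def inj_on_def)

text \<open>
  Follow the alternating path from \<open>y\<close>, leaving \<open>Y\<close> along color \<open>a\<close> and \<open>X\<close> along color \<open>b\<close>. It
  enters \<open>X\<close> only along \<open>a\<close>, hence misses \<open>x\<close>, and the two colors can be exchanged on it.
\<close>

lemma kempe_exchange:
  assumes disj: "X \<inter> Y = {}"
    and bip: "\<And>e. e \<in> E \<Longrightarrow> \<exists>x\<in>X. \<exists>y\<in>Y. e = {x, y}"
    and proper: "proper_coloring E c"
    and x: "x \<in> X" "\<And>e. e \<in> E \<Longrightarrow> x \<in> e \<Longrightarrow> c e \<noteq> a"
    and y: "y \<in> Y" "\<And>e. e \<in> E \<Longrightarrow> y \<in> e \<Longrightarrow> c e \<noteq> b"
  shows "\<exists>c'. proper_coloring E c' \<and> c' ` E \<subseteq> c ` E \<union> {a, b} \<and>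
    (\<forall>e\<in>E. x \<in> e \<or> y \<in> e \<longrightarrow> c' e \<noteq> a)"
proof -
  define r where "r p q \<longleftrightarrow> {p, q} \<in> E \<and>
      (p \<in> Y \<and> c {p, q} = a \<or> p \<in> X \<and> c {p, q} = b)" for p q
  define P where "P = {p. r\<^sup>*\<^sup>* y p}"
  define K where "K = {e \<in> E. c e \<in> {a, b} \<and> e \<inter> P \<noteq> {}}"
  define c' where "c' e = (if e \<in> K then if c e = a then b else a else c e)" for e
  have sides: "p \<in> X \<and> q \<in> Y \<or> p \<in> Y \<and> q \<in> X" if "{p, q} \<in> E" for p q
    using bip[OF that] by (auto simp: doubleton_eq_iff)
  have step: "q \<in> P" if "p \<in> P" "r p q" for p q
    using that by (auto simp: P_def)
  have entered: "p = y \<or> (\<exists>q\<in>P. r q p)" if "p \<in> P" for p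
    using that unfolding P_def by (auto elim: rtranclp.cases)
  \<comment> \<open>\<open>r\<close> is directed, but \<open>P\<close> turns out to be closed under
    all edges colored \<open>a\<close> or \<open>b\<close>, in either direction.\<close>
  have closed: "q \<in> P" if "p \<in> P" "{p, q} \<in> E" "c {p, q} \<in> {a, b}" for p q
  proof (cases "r p q")
    case True
    then show ?thesis
      using step that by blast
  next
    case False
    \<comment> \<open>An edge at \<open>y\<close> not followed by \<open>r\<close> would have color
      \<open>b\<close>, which \<open>y\<close> misses. Any other \<open>p\<close> was entered along
      the color of \<open>{p, q}\<close>, so properness forces \<open>q\<close> to be the
      predecessor \<open>p'\<close>.\<close>
    then have "p \<noteq> y"
      using that y by (auto simp: r_def)
    then obtain p' where p': "p' \<in> P" "r p' p"
      using entered \<open>p \<in> P\<close> by blast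
    have "p \<in> X \<and> p \<notin> Y \<and> p' \<in> Y \<and> p' \<notin> X \<or> p \<in> Y \<and> p \<notin> X \<and> p' \<in> X \<and> p' \<notin> Y"
      using sides[of p' p] p'(2) disj unfolding r_def by blast
    then have "c {p', p} = c {p, q}"
      using p'(2) False that(2,3) unfolding r_def by fastforce
    moreover have "{p', p} \<in> E"
      using p'(2) unfolding r_def by blast
    ultimately have "{p', p} = {p, q}"
      using proper_coloringD[OF proper _ that(2), of _ p] by blast
    then show ?thesis
      using p' \<open>p \<in> P\<close> unfolding doubleton_eq_iff by blast
  qed
  have "x \<notin> P"
  proof
    assume "x \<in> P"
    moreover have "x \<noteq> y"
      using x y disj by auto
    ultimately obtain p where "r p x"
      using entered by blast
    then have "{p, x} \<in> E" "c {p, x} = a"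
      using sides[of p x] x disj by (auto simp: r_def)
    then show False
      using x by auto
  qed
  \<comment> \<open>Membership in \<open>K\<close> can be tested at any end of an edge. Hence at
    each vertex the exchange affects all edges colored \<open>a\<close> or \<open>b\<close> or none
    of them, which preserves properness.\<close>
  have K_iff: "e \<in> K \<longleftrightarrow> v \<in> P" if "e \<in> E" "v \<in> e" "c e \<in> {a, b}" for e v
  proof -
    obtain w where w: "e = {v, w}"
      using bip[OF \<open>e \<in> E\<close>] \<open>v \<in> e\<close> by (auto simp: insert_commute)
    have "w \<in> P \<Longrightarrow> v \<in> P"
      using closed[of w v] that w by (simp add: insert_commute)
    then show ?thesis
      using that w by (auto simp: K_def)
  qed
  have "proper_coloring E c'"
    unfolding proper_coloring_def
  proof (intro allI inj_onI)
    fix v e f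
    assume "e \<in> {e \<in> E. v \<in> e}" "f \<in> {e \<in> E. v \<in> e}" and eq: "c' e = c' f"
    then have ef: "e \<in> E" "v \<in> e" "f \<in> E" "v \<in> f"
      by auto
    have "c g \<in> {a, b}" if "g \<in> K" for g
      using that by (simp add: K_def)
    then have "c e = c f"
      using eq K_iff[OF ef(1,2)] K_iff[OF ef(3,4)] by (auto simp: c'_def split: if_splits)
    then show "e = f"
      using proper_coloringD[OF proper] ef by blast
  qed
  moreover have "c' ` E \<subseteq> c ` E \<union> {a, b}"
    by (auto simp: c'_def)
  moreover have "c' e \<noteq> a" if "e \<in> E" "x \<in> e \<or> y \<in> e" for e
  proof
    assume "c' e = a"
    \<comment> \<open>At \<open>x\<close>, an old \<open>a\<close> is missing and no edge of
      \<open>K\<close> arrives; at \<open>y\<close>, an old \<open>b\<close> is missing and every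
      edge colored \<open>a\<close> lies in \<open>K\<close>.\<close>
    then have *: "c e = a \<and> e \<notin> K \<or> c e = b \<and> e \<in> K"
      by (auto simp: c'_def K_def split: if_splits)
    have "y \<in> P"
      by (simp add: P_def)
    then show False
      using that(2) * K_iff[OF that(1)] \<open>x \<notin> P\<close> x(2) y(2) that(1) by auto
  qed
  ultimately show ?thesis
    by blast
qed

lemma missing_color_exists:
  assumes "finite F" "card F < k"
  shows "\<exists>a\<in>{1..k}. \<forall>e\<in>F. c e \<noteq> a"
proof (rule ccontr)
  assume "\<not> ?thesis"
  then have "{1..k} \<subseteq> c ` F"
    by auto
  then have "k \<le> card (c ` F)"
    using card_mono[of "c ` F" "{1..k}"] assms by simp
  then show False
    using card_image_le[OF assms(1), of c] assms(2) by linarith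
qed

text \<open>Edges are added one at a time. Each end of the new edge misses some color, and a Kempe
  exchange makes one color \<open>a\<close> missing at both ends, free for the new edge.\<close>

theorem koenig_edge_coloring:
  assumes "finite E" and disj: "X \<inter> Y = {}"
    and "\<And>e. e \<in> E \<Longrightarrow> \<exists>x\<in>X. \<exists>y\<in>Y. e = {x, y}"
    and "\<And>v. degree E v \<le> k"
  shows "\<exists>c. proper_coloring E c \<and> c ` E \<subseteq> {1..k}"
  using assms(1,3,4)
proof (induction E)
  case empty
  then show ?case
    by (simp add: proper_coloring_def)
next
  case (insert e E)
  have le: "degree E v \<le> k" for v
  proof -
    have "degree E v \<le> degree (insert e E) v"
      unfolding degree_def using insert.hyps by (intro card_mono) auto
    then show ?thesis
      using insert.prems(2)[of v] by simp
  qed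
  then obtain c where c: "proper_coloring E c" "c ` E \<subseteq> {1..k}"
    using insert by blast
  obtain x y where xy: "x \<in> X" "y \<in> Y" "e = {x, y}"
    using insert.prems(1) by blast
  have free: "\<exists>a\<in>{1..k}. \<forall>f\<in>{f \<in> E. v \<in> f}. c f \<noteq> a" if "v \<in> e" for v
  proof (rule missing_color_exists)
    \<comment> \<open>The new edge \<open>e\<close> itself uses up one unit of the degree bound,
      which makes the inequality for \<open>E\<close> strict.\<close>
    have "{f \<in> insert e E. v \<in> f} = insert e {f \<in> E. v \<in> f}"
      using that by auto
    then show "card {f \<in> E. v \<in> f} < k"
      using insert.prems(2)[of v] insert.hyps by (simp add: degree_def)
  qed (use insert.hyps in simp)
  obtain a where a: "a \<in> {1..k}" "\<forall>f\<in>{f \<in> E. x \<in> f}. c f \<noteq> a"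
    using free[of x] xy by auto
  obtain b where b: "b \<in> {1..k}" "\<forall>f\<in>{f \<in> E. y \<in> f}. c f \<noteq> b"
    using free[of y] xy by auto
  obtain c' where c': "proper_coloring E c'" "c' ` E \<subseteq> c ` E \<union> {a, b}"
      "\<forall>f\<in>E. x \<in> f \<or> y \<in> f \<longrightarrow> c' f \<noteq> a"
    using kempe_exchange[OF disj _ c(1), of x a y b] insert.prems(1) xy a b by auto
  have "proper_coloring (insert e E) (c'(e := a))"
    unfolding proper_coloring_def
  proof (intro allI inj_onI)
    fix v f g
    assume "f \<in> {f \<in> insert e E. v \<in> f}" "g \<in> {f \<in> insert e E. v \<in> f}"
      and "(c'(e := a)) f = (c'(e := a)) g"
    then show "f = g"
      using c'(3) xy(3) proper_coloringD[OF c'(1), of f g v] by (auto split: if_splits)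
  qed
  moreover have "(c'(e := a)) ` insert e E \<subseteq> {1..k}"
  proof -
    have "c' ` E \<subseteq> {1..k}"
      using c'(2) c(2) a(1) b(1) by blast
    then show ?thesis
      using a(1) by (auto simp del: atLeastAtMost_iff)
  qed
  ultimately show ?case
    by blast
qed

section \<open>Upper bound from stars, and the value of \<open>rd\<close>\<close>

lemma proper_coloring_rainbow_disconnected:
  assumes "proper_coloring E c"
  shows "rainbow_disconnected V E c"
  unfolding rainbow_disconnected_def
proof (intro ballI impI)
  fix u v assume uv: "u \<in> V" "v \<in> V" "u \<noteq> v"
  let ?R = "{e \<in> E. u \<in> e}"
  have isolated: "\<not> reachable (E - ?R) u w" if "w \<noteq> u" for w
    using that by (auto simp: reachable_def adjacent_def elim: converse_rtranclpE)
  then have "edge_cut V E ?R"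
    using isolated[of v] uv unfolding edge_cut_def connected_graph_def by blast
  moreover have "v \<in> component V (E - ?R) v" "v \<notin> component V (E - ?R) u"
    using isolated uv by (auto simp: component_def reachable_def)
  ultimately have "separating_rainbow_cut V E c u v ?R"
    using assms by (auto simp: separating_rainbow_cut_def rainbow_cut_def proper_coloring_def)
  then show "\<exists>R. separating_rainbow_cut V E c u v R"
    by blast
qed

theorem theorem5:
  fixes V :: "'a set" and E :: "'a set set" and k :: nat
  assumes "simple_graph V E"
    and "card V \<ge> 2"
    and "connected_graph V E"
    and "regular_graph k V E"
    and "bipartite_graph V E"
  shows "rd V E = k"
proof -
  interpret simple_graph V E
    by fact
  obtain X Y where XY: "X \<inter> Y = {}" "\<And>e. e \<in> E \<Longrightarrow> \<exists>x\<in>X. \<exists>y\<in>Y. e = {x, y}"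
    using assms(5) unfolding bipartite_graph_def by metis
  \<comment> \<open>The coloring theorem asks for the bound at every element of the type, so
    elements outside \<open>V\<close>, which lie on no edge, are treated as well.\<close>
  have "degree E v \<le> k" for v
  proof (cases "v \<in> V")
    case True
    then show ?thesis
      using assms(4) by (simp add: regular_graph_def)
  next
    case False
    then have "{e \<in> E. v \<in> e} = {}"
      using edge_subset by blast
    then show ?thesis
      by (simp only: degree_def card.empty)
  qed
  then obtain c where "proper_coloring E c" "c ` E \<subseteq> {1..k}"
    using koenig_edge_coloring[of E X Y k, OF finite_edges XY] by metis
  then have "\<exists>c. c ` E \<subseteq> {1..k} \<and> rainbow_disconnected V E c"
    using proper_coloring_rainbow_disconnected by blast
  then show ?thesis
    unfolding rd_def using rainbow_disconnected_lower_bound[OF assms(1,2,4)]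
    by (intro Least_equality) auto
qed

end
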